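(* Let $S=\mathcal{M}^0[G;I,\Lambda;P]$ be a completely $0$-simple semigroup. Then $S$ is right uniform if and only if $I$ is a singleton; equivalently, $S$ is right uniform if and only if $S$ is a right $0$-group.
   Context: A right $S$-act is a nonempty set $A$ with a map $A\times S\to A$, $(a,s)\mapsto as$, with $a(st)=(as)t$. A subact is a nonempty subset closed under the action; an $S$-homomorphism is a map $f$ with $f(as)=f(a)s$. A subact is nonzero if it is not a one-element subact. A subact $B$ of $A$ is large in $A$ if every $S$-homomorphism $g:A\to C$ (for any right $S$-act $C$) whose restriction to $B$ is injective is itself injective. A right $S$-act is uniform if every nonzero subact is large in it. A semigroup $S$ is right uniform if the right $S$-act $S_S$ ($S$ acting on itself by right multiplication; its subacts are the nonempty right ideals) is uniform. $\mathcal{M}^0[G;I,\Lambda;P]$ is the Rees matrix semigroup: $G$ is a group, $I,\Lambda$ are nonempty sets, $P=(p_{\lambda i})$ is a $\Lambda\times I$ matrix with entries in $G\cup\{0\}$ that is regular (every row and every column has a nonzero entry), the underlying set is $(I\times G\times\Lambda)\cup\{0\}$, $0$ is the zero element, and $(i,g,\lambda)(j,h,\mu)=(i,g\,p_{\lambda j}h,\mu)$ if $p_{\lambda j}\ne 0$ and $=0$ otherwise. A right group is a semigroup that is right simple (its only right ideal is itself) and left cancellative; a right $0$-group is $T^0=T\cup\{0\}$, a right group $T$ with a new zero element adjoined (also when $T$ is trivial). *)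

theory Defs
  imports "HOL-Algebra.Group"
begin

section \<open>Semigroups with explicit carrier\<close>

record 'a sgrp = "'a partial_object" +
  smult :: "'a \<Rightarrow> 'a \<Rightarrow> 'a" (infixl \<open>\<odot>\<index>\<close> 70)

definition is_semigroup :: "('a, 'm) sgrp_scheme \<Rightarrow> bool" where
  "is_semigroup S \<longleftrightarrow>
     carrier S \<noteq> {} \<and>
     (\<forall>x\<in>carrier S. \<forall>y\<in>carrier S. x \<odot>\<^bsub>S\<^esub> y \<in> carrier S) \<and>
     (\<forall>x\<in>carrier S. \<forall>y\<in>carrier S. \<forall>z\<in>carrier S.
        (x \<odot>\<^bsub>S\<^esub> y) \<odot>\<^bsub>S\<^esub> z = x \<odot>\<^bsub>S\<^esub> (y \<odot>\<^bsub>S\<^esub> z))"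


section \<open>Right acts\<close>

record ('s, 'a) ract = "'a partial_object" +
  act :: "'a \<Rightarrow> 's \<Rightarrow> 'a"

definition right_act :: "('s, 'm) sgrp_scheme \<Rightarrow> ('s, 'a) ract \<Rightarrow> bool" where
  "right_act S A \<longleftrightarrow>
     carrier A \<noteq> {} \<and>
     (\<forall>a\<in>carrier A. \<forall>s\<in>carrier S. act A a s \<in> carrier A) \<and>
     (\<forall>a\<in>carrier A. \<forall>s\<in>carrier S. \<forall>t\<in>carrier S.
        act A a (s \<odot>\<^bsub>S\<^esub> t) = act A (act A a s) t)"

definition subact :: "('s, 'm) sgrp_scheme \<Rightarrow> ('s, 'a) ract \<Rightarrow> 'a set \<Rightarrow> bool" where
  "subact S A B \<longleftrightarrow>
     B \<noteq> {} \<and> B \<subseteq> carrier A \<and> (\<forall>b\<in>B. \<forall>s\<in>carrier S. act A b s \<in> B)"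

definition nonzero_subact :: "('s, 'm) sgrp_scheme \<Rightarrow> ('s, 'a) ract \<Rightarrow> 'a set \<Rightarrow> bool" where
  "nonzero_subact S A B \<longleftrightarrow> subact S A B \<and> \<not> is_singleton B"

definition act_hom ::
    "('s, 'm) sgrp_scheme \<Rightarrow> ('s, 'a) ract \<Rightarrow> ('s, 'c) ract \<Rightarrow> ('a \<Rightarrow> 'c) set" where
  "act_hom S A C =
     {f. (\<forall>a\<in>carrier A. f a \<in> carrier C) \<and>
         (\<forall>a\<in>carrier A. \<forall>s\<in>carrier S. f (act A a s) = act C (f a) s)}"

text \<open>
  HOL cannot quantify over all types inside a definition, so the target act \<open>C\<close>
  ranges over the acts whose elements have the same type as those of \<open>A\<close>. Nothing is lost:
  the lemma \<open>large_subactD\<close> below gives the property for targets of arbitrary type.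
\<close>

definition large_subact :: "('s, 'm) sgrp_scheme \<Rightarrow> ('s, 'a) ract \<Rightarrow> 'a set \<Rightarrow> bool" where
  "large_subact S A B \<longleftrightarrow>
     subact S A B \<and>
     (\<forall>(C :: ('s, 'a) ract) g.
        right_act S C \<longrightarrow> g \<in> act_hom S A C \<longrightarrow> inj_on g B \<longrightarrow> inj_on g (carrier A))"

lemma large_subactD:
  fixes S :: "('s, 'm) sgrp_scheme" and A :: "('s, 'a) ract" and C :: "('s, 'c) ract"
  assumes A: "right_act S A" and B: "large_subact S A B"
    and C: "right_act S C" and g: "g \<in> act_hom S A C" and inj: "inj_on g B"
  shows "inj_on g (carrier A)"
proof -
  define h where "h = inv_into (carrier A) g"
  define D :: "('s, 'a) ract" where
    "D = \<lparr>carrier = (h \<circ> g) ` carrier A, act = (\<lambda>a s. h (act C (g a) s))\<rparr>"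
  have gh: "g (h (g a)) = g a" if "a \<in> carrier A" for a
    using that by (simp add: h_def f_inv_into_f)
  have gact: "act C (g a) s = g (act A a s)" if "a \<in> carrier A" "s \<in> carrier S" for a s
    using g that by (simp add: act_hom_def)
  have Acl: "act A a s \<in> carrier A" if "a \<in> carrier A" "s \<in> carrier S" for a s
    using A that by (simp add: right_act_def)
  have gC: "g a \<in> carrier C" if "a \<in> carrier A" for a
    using g that by (simp add: act_hom_def)
  have Cassoc: "act C c (s \<odot>\<^bsub>S\<^esub> t) = act C (act C c s) t"
    if "c \<in> carrier C" "s \<in> carrier S" "t \<in> carrier S" for c s t
    using C that by (simp add: right_act_def)
  have act_D: "act D (h (g a)) s = h (g (act A a s))" if "a \<in> carrier A" "s \<in> carrier S" for a s
    using that by (simp add: D_def gh gact)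
  have ne: "carrier A \<noteq> {}"
    using A by (simp add: right_act_def)
  have car_D: "carrier D = (\<lambda>a. h (g a)) ` carrier A"
    by (auto simp: D_def)
  have act_D_assoc: "act D (h (g a)) (s \<odot>\<^bsub>S\<^esub> t) = act D (act D (h (g a)) s) t"
    if "a \<in> carrier A" "s \<in> carrier S" "t \<in> carrier S" for a s t
  proof -
    have "act D (h (g a)) (s \<odot>\<^bsub>S\<^esub> t) = h (act C (act C (g a) s) t)"
      using that by (simp add: D_def gh Cassoc gC)
    also have "\<dots> = h (g (act A (act A a s) t))"
      using that by (simp add: gact Acl)
    also have "\<dots> = act D (act D (h (g a)) s) t"
      using that by (simp add: act_D Acl)
    finally show ?thesis .
  qed
  have "right_act S D"
    unfolding right_act_def car_D
    using ne Acl by (simp add: act_D act_D_assoc)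
  moreover have "h \<circ> g \<in> act_hom S A D"
    using car_D by (simp add: act_hom_def act_D)
  moreover have "B \<subseteq> carrier A"
    using B by (simp add: large_subact_def subact_def)
  then have "inj_on (h \<circ> g) B"
    using inj gh unfolding inj_on_def by (metis comp_apply subsetD)
  ultimately have "inj_on (h \<circ> g) (carrier A)"
    using B by (simp add: large_subact_def)
  then show ?thesis
    by (rule inj_on_imageI2)
qed

definition uniform_act :: "('s, 'm) sgrp_scheme \<Rightarrow> ('s, 'a) ract \<Rightarrow> bool" where
  "uniform_act S A \<longleftrightarrow> (\<forall>B. nonzero_subact S A B \<longrightarrow> large_subact S A B)"

definition regular_act :: "('s, 'm) sgrp_scheme \<Rightarrow> ('s, 's) ract" where
  "regular_act S = \<lparr>carrier = carrier S, act = smult S\<rparr>"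

definition right_uniform :: "('s, 'm) sgrp_scheme \<Rightarrow> bool" where
  "right_uniform S \<longleftrightarrow> uniform_act S (regular_act S)"


section \<open>Right groups and right 0-groups\<close>

definition right_ideal :: "('s, 'm) sgrp_scheme \<Rightarrow> 's set \<Rightarrow> bool" where
  "right_ideal S R \<longleftrightarrow> subact S (regular_act S) R"

definition right_group :: "('s, 'm) sgrp_scheme \<Rightarrow> bool" where
  "right_group T \<longleftrightarrow>
     is_semigroup T \<and>
     (\<forall>R. right_ideal T R \<longrightarrow> R = carrier T) \<and>
     (\<forall>a\<in>carrier T. \<forall>x\<in>carrier T. \<forall>y\<in>carrier T.
        a \<odot>\<^bsub>T\<^esub> x = a \<odot>\<^bsub>T\<^esub> y \<longrightarrow> x = y)"

definition right_0_group :: "('s, 'm) sgrp_scheme \<Rightarrow> bool" where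
  "right_0_group S \<longleftrightarrow>
     (\<exists>T z. right_group (S\<lparr>carrier := T\<rparr>) \<and> z \<notin> T \<and> carrier S = T \<union> {z} \<and>
        (\<forall>x\<in>carrier S. x \<odot>\<^bsub>S\<^esub> z = z \<and> z \<odot>\<^bsub>S\<^esub> x = z))"


section \<open>Rees matrix semigroups\<close>

text \<open>
  The value \<open>None\<close> stands for \<open>0\<close>, both as an entry of the sandwich matrix \<open>P\<close> and as the
  zero of the semigroup. The condition \<open>regular_matrix\<close> includes that the entries of \<open>P\<close>
  lie in \<open>G \<union> {0}\<close>.
\<close>

definition regular_matrix ::
    "('g, 'm) monoid_scheme \<Rightarrow> 'i set \<Rightarrow> 'l set \<Rightarrow> ('l \<Rightarrow> 'i \<Rightarrow> 'g option) \<Rightarrow> bool" where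
  "regular_matrix G I \<Lambda> P \<longleftrightarrow>
     (\<forall>l\<in>\<Lambda>. \<forall>i\<in>I. P l i \<in> insert None (Some ` carrier G)) \<and>
     (\<forall>l\<in>\<Lambda>. \<exists>i\<in>I. P l i \<noteq> None) \<and>
     (\<forall>i\<in>I. \<exists>l\<in>\<Lambda>. P l i \<noteq> None)"

fun rees_mult ::
    "('g, 'm) monoid_scheme \<Rightarrow> ('l \<Rightarrow> 'i \<Rightarrow> 'g option) \<Rightarrow>
     ('i \<times> 'g \<times> 'l) option \<Rightarrow> ('i \<times> 'g \<times> 'l) option \<Rightarrow> ('i \<times> 'g \<times> 'l) option" where
  "rees_mult G P (Some (i, g, l)) (Some (j, h, m)) =
     (case P l j of None \<Rightarrow> None | Some p \<Rightarrow> Some (i, g \<otimes>\<^bsub>G\<^esub> p \<otimes>\<^bsub>G\<^esub> h, m))"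
| "rees_mult G P _ _ = None"

definition rees_matrix_semigroup ::
    "('g, 'm) monoid_scheme \<Rightarrow> 'i set \<Rightarrow> 'l set \<Rightarrow> ('l \<Rightarrow> 'i \<Rightarrow> 'g option) \<Rightarrow>
     ('i \<times> 'g \<times> 'l) option sgrp" where
  "rees_matrix_semigroup G I \<Lambda> P =
     \<lparr>carrier = insert None (Some ` (I \<times> carrier G \<times> \<Lambda>)), smult = rees_mult G P\<rparr>"

end

theory Submission
  imports Defs
begin

text \<open>
  If \<open>I = {i}\<close>, regularity forces all entries of \<open>P\<close> to be nonzero, so every nonzero element
  generates \<open>S\<close> as a right ideal: the nonzero elements are then a right group and \<open>S\<close> is the only
  nonzero right ideal. If \<open>I\<close> has two elements \<open>i\<close> and \<open>j\<close>, the retraction of \<open>S\<close> onto the right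
  ideal \<open>{i} \<times> G \<times> \<Lambda> \<union> {0}\<close> that sends everything else to \<open>0\<close> is a homomorphism of right acts. It is
  injective on that ideal but collapses row \<open>j\<close>, so \<open>S\<close> is not right uniform. In a right
  0-group \<open>T \<union> {0}\<close> of this form, \<open>{i} \<times> G \<times> \<Lambda>\<close> is a right ideal of \<open>T\<close>, hence all of \<open>T\<close>.
\<close>

locale regular_rees = group G for G (structure) +
  fixes I :: "'i set" and \<Lambda> :: "'l set" and P :: "'l \<Rightarrow> 'i \<Rightarrow> 'a option"
  assumes I_nonempty: "I \<noteq> {}" and \<Lambda>_nonempty: "\<Lambda> \<noteq> {}" and regular: "regular_matrix G I \<Lambda> P"
begin

abbreviation S :: "('i \<times> 'a \<times> 'l) option sgrp" where
  "S \<equiv> rees_matrix_semigroup G I \<Lambda> P"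

text \<open>Zero is left out so that distinct rows are disjoint and a row can serve as the carrier
  of a right group; for \<open>i\<close> in \<open>I\<close>, the right ideal of \<open>S\<close> is
  \<open>insert None (row i)\<close>.\<close>

definition row :: "'i \<Rightarrow> ('i \<times> 'a \<times> 'l) option set" where
  "row i = Some ` ({i} \<times> carrier G \<times> \<Lambda>)"

lemma mem_row [simp]:
  "None \<notin> row i" "Some (j, g, l) \<in> row i \<longleftrightarrow> j = i \<and> g \<in> carrier G \<and> l \<in> \<Lambda>"
  by (auto simp: row_def)

lemma row_cases:
  assumes "x \<in> row i"
  obtains g l where "x = Some (i, g, l)" "g \<in> carrier G" "l \<in> \<Lambda>"
  using assms by (auto simp: row_def)

lemma carrier_S: "carrier S = insert None (\<Union>i\<in>I. row i)"
  by (auto simp: rees_matrix_semigroup_def row_def)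

lemma carrier_S_singleton: "I = {i} \<Longrightarrow> carrier S = insert None (row i)"
  using carrier_S by simp

lemma smult_S [simp]: "x \<odot>\<^bsub>rees_matrix_semigroup G J M P\<^esub> y = rees_mult G P x y"
  by (simp add: rees_matrix_semigroup_def)

lemma mult_None [simp]: "rees_mult G P x None = None" "rees_mult G P None x = None"
  by (cases x; auto)+

lemma entry_closed: "p \<in> carrier G" if "l \<in> \<Lambda>" "i \<in> I" "P l i = Some p"
proof -
  have "P l i \<in> insert None (Some ` carrier G)"
    using regular that(1,2) unfolding regular_matrix_def by blast
  then show ?thesis using that(3) by auto
qed

text \<open>The left factor alone fixes the first coordinate of a nonzero product.\<close>

lemma mult_mem_row:
  assumes "x \<in> row i" "y \<in> carrier S"
  shows "rees_mult G P x y \<in> insert None (row i)"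
  using assms by (auto elim!: row_cases simp: carrier_S entry_closed split: option.splits)

lemma mult_closed:
  assumes "x \<in> carrier S" "y \<in> carrier S"
  shows "rees_mult G P x y \<in> carrier S"
  using assms mult_mem_row by (fastforce simp: carrier_S)

text \<open>For nonzero factors, both sides vanish once one of the two sandwich entries does;
  otherwise associativity in \<open>G\<close> applies.\<close>

lemma mult_assoc:
  assumes "x \<in> carrier S" "y \<in> carrier S" "z \<in> carrier S"
  shows "rees_mult G P (rees_mult G P x y) z = rees_mult G P x (rees_mult G P y z)"
  using assms
  by (auto elim!: row_cases simp: carrier_S entry_closed m_assoc split: option.split)

lemma right_act_regular: "right_act S (regular_act S)"
  using mult_closed mult_assoc
  by (auto simp: right_act_def regular_act_def carrier_S)

lemma row_nonempty: "row i \<noteq> {}"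
  using \<Lambda>_nonempty by (auto simp: row_def)

lemma is_singleton_I_if_right_uniform:
  assumes "right_uniform S"
  shows "is_singleton I"
proof -
  obtain i where i: "i \<in> I" using I_nonempty by blast
  let ?B = "insert None (row i)"
  define f where "f x = (if x \<in> row i then x else None)" for x
  have "nonzero_subact S (regular_act S) ?B"
    using i row_nonempty[of i] mult_mem_row[of _ i]
    by (auto simp: nonzero_subact_def subact_def regular_act_def carrier_S is_singleton_def)
  then have "large_subact S (regular_act S) ?B"
    using assms by (simp add: right_uniform_def uniform_act_def)
  moreover have "f \<in> act_hom S (regular_act S) (regular_act S)"
  proof -
    have "f (rees_mult G P x s) = rees_mult G P (f x) s"
      if x: "x \<in> carrier S" and s: "s \<in> carrier S" for x s
    proof (cases "x \<in> row i")
      case True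
      then show ?thesis using mult_mem_row[OF True s] by (auto simp: f_def)
    next
      case False
      show ?thesis
      proof (cases x)
        case (Some a)
        then obtain j where "j \<in> I" "x \<in> row j" using x by (auto simp: carrier_S)
        \<comment> \<open>A product whose left factor lies in another row is zero or stays in that
          row, so \<open>f\<close> kills both \<open>x\<close> and the product.\<close>
        then have "rees_mult G P x s \<in> insert None (row j)" "j \<noteq> i"
          using mult_mem_row s False by auto
        then have "rees_mult G P x s \<notin> row i" by (auto elim!: row_cases)
        then show ?thesis using False by (simp add: f_def)
      qed (simp add: f_def)
    qed
    moreover have "f x \<in> carrier S" if "x \<in> carrier S" for x
      using that by (simp add: f_def carrier_S)
    ultimately show ?thesis by (simp add: act_hom_def regular_act_def)
  qed
  moreover have "inj_on f ?B" by (auto simp: inj_on_def f_def)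
  \<comment> \<open>The target act is \<open>S\<close> itself, whose elements have the type over
    which \<open>large_subact\<close> quantifies.\<close>
  ultimately have "inj_on f (carrier S)"
    using right_act_regular unfolding large_subact_def by (auto simp: regular_act_def)
  moreover obtain l where "l \<in> \<Lambda>" using \<Lambda>_nonempty by blast
  \<comment> \<open>For \<open>j\<close> different from \<open>i\<close>, both
    \<open>Some (j, \<one>, l)\<close> and zero would be sent to zero.\<close>
  ultimately have "j = i" if "j \<in> I" for j
    using that inj_onD[of f "carrier S" "Some (j, \<one>, l)" None]
    by (auto simp: f_def carrier_S split: if_splits)
  then show ?thesis using i by (auto simp: is_singleton_def)
qed

text \<open>Row \<open>l\<close> of \<open>P\<close> has a nonzero entry, and \<open>i\<close> is
  the only column.\<close>

lemma entry_nonzero_if_singleton: "\<exists>p\<in>carrier G. P l i = Some p" if "I = {i}" "l \<in> \<Lambda>"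
  using regular that entry_closed[OF that(2), of i] by (auto simp: regular_matrix_def)

text \<open>Right simplicity of the row, used for the right ideals of \<open>S\<close> and for those
  of the row itself.\<close>

lemma row_mult_surj:
  assumes I: "I = {i}" and "x \<in> row i" "y \<in> row i"
  shows "\<exists>s\<in>row i. rees_mult G P x s = y"
proof -
  obtain g l where x: "x = Some (i, g, l)" "g \<in> carrier G" "l \<in> \<Lambda>"
    using assms(2) by (rule row_cases)
  obtain h m where y: "y = Some (i, h, m)" "h \<in> carrier G" "m \<in> \<Lambda>"
    using assms(3) by (rule row_cases)
  obtain p where p: "p \<in> carrier G" "P l i = Some p"
    using entry_nonzero_if_singleton[OF I x(3)] by blast
  \<comment> \<open>The middle coordinate is the solution \<open>u\<close> of
    \<open>g \<otimes> p \<otimes> u = h\<close>.\<close>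
  have "rees_mult G P x (Some (i, inv (g \<otimes> p) \<otimes> h, m)) = y"
    using x y p by (simp add: m_assoc[symmetric])
  moreover have "Some (i, inv (g \<otimes> p) \<otimes> h, m) \<in> row i"
    using x y p by simp
  ultimately show ?thesis by blast
qed

lemma right_uniform_if_singleton:
  assumes I: "I = {i}"
  shows "right_uniform S"
proof -
  \<comment> \<open>The whole act is trivially large in itself, so it suffices that no other subact
    is nonzero.\<close>
  have "B = carrier S" if "nonzero_subact S (regular_act S) B" for B
  proof -
    have B: "B \<noteq> {}" "B \<subseteq> carrier S" "\<not> is_singleton B"
      and closed: "\<And>b s. b \<in> B \<Longrightarrow> s \<in> carrier S \<Longrightarrow> rees_mult G P b s \<in> B"
      using that by (auto simp: nonzero_subact_def subact_def regular_act_def)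
    obtain x where "x \<in> B" "x \<noteq> None" using B(1,3) is_singletonI'[of B] by metis
    then have x: "x \<in> B" "x \<in> row i" using B(2) unfolding carrier_S_singleton[OF I] by auto
    have "None \<in> B" using closed[OF x(1), of None] by (simp add: carrier_S)
    moreover have "row i \<subseteq> B"
      using row_mult_surj[OF I x(2)] closed[OF x(1)]
      unfolding carrier_S_singleton[OF I] by blast
    ultimately show ?thesis using B(2) unfolding carrier_S_singleton[OF I] by blast
  qed
  then show ?thesis
    unfolding right_uniform_def uniform_act_def large_subact_def
    by (auto simp: nonzero_subact_def regular_act_def)
qed

lemma right_0_group_if_singleton:
  assumes I: "I = {i}"
  shows "right_0_group S"
proof -
  have closed: "rees_mult G P x y \<in> row i" if "x \<in> row i" "y \<in> row i" for x y
    using that entry_nonzero_if_singleton[OF I] by (fastforce elim!: row_cases)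
  have row_subset: "row i \<subseteq> carrier S" using carrier_S_singleton[OF I] by blast
  have "right_group (S\<lparr>carrier := row i\<rparr>)"
    unfolding right_group_def
  proof (intro conjI allI impI ballI)
    show "is_semigroup (S\<lparr>carrier := row i\<rparr>)"
      using closed mult_assoc row_nonempty row_subset by (simp add: is_semigroup_def subset_iff)
  next
    fix R assume "right_ideal (S\<lparr>carrier := row i\<rparr>) R"
    then have R: "R \<noteq> {}" "R \<subseteq> row i" "\<And>b s. b \<in> R \<Longrightarrow> s \<in> row i \<Longrightarrow> rees_mult G P b s \<in> R"
      by (auto simp: right_ideal_def subact_def regular_act_def)
    then obtain x where x: "x \<in> R" "x \<in> row i" by blast
    then have "row i \<subseteq> R" using row_mult_surj[OF I x(2)] R(3) by blast
    then show "R = carrier (S\<lparr>carrier := row i\<rparr>)" using R(2) by auto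
  next
    fix a x y
    assume "a \<in> carrier (S\<lparr>carrier := row i\<rparr>)" "x \<in> carrier (S\<lparr>carrier := row i\<rparr>)"
      "y \<in> carrier (S\<lparr>carrier := row i\<rparr>)"
      "a \<odot>\<^bsub>S\<lparr>carrier := row i\<rparr>\<^esub> x = a \<odot>\<^bsub>S\<lparr>carrier := row i\<rparr>\<^esub> y"
    \<comment> \<open>The last coordinates agree at once; in the middle ones the common left factor,
      an element of \<open>G\<close>, cancels.\<close>
    then show "x = y"
      using entry_nonzero_if_singleton[OF I] by (fastforce elim!: row_cases)
  qed
  then show ?thesis
    unfolding right_0_group_def
    by (intro exI[of _ "row i"] exI[of _ None]) (simp add: carrier_S_singleton[OF I])
qed

lemma is_singleton_I_if_right_0_group:
  assumes "right_0_group S"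
  shows "is_singleton I"
proof -
  obtain T z where T: "right_group (S\<lparr>carrier := T\<rparr>)" and z: "z \<notin> T" "carrier S = T \<union> {z}"
    and zero: "\<forall>x\<in>carrier S. rees_mult G P x z = z \<and> rees_mult G P z x = z"
    using assms by (auto simp: right_0_group_def)
  \<comment> \<open>The adjoined zero is not given as \<open>None\<close>, but the product of the
    two zeros equals each of them.\<close>
  have "z = None"
    using zero by (auto simp: carrier_S)
  then have T_eq: "T = (\<Union>i\<in>I. row i)"
    using z carrier_S insert_ident[of None T "\<Union>i\<in>I. row i"] by simp
  have closed: "rees_mult G P x y \<in> T" if "x \<in> T" "y \<in> T" for x y
    using T that by (auto simp: right_group_def is_semigroup_def)
  obtain i where i: "i \<in> I" using I_nonempty by blast
  \<comment> \<open>Since \<open>T\<close> is closed under products and omits zero, the zero case of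
    \<open>mult_mem_row\<close> cannot occur.\<close>
  have "rees_mult G P b s \<in> row i" if "b \<in> row i" "s \<in> T" for b s
  proof -
    have "rees_mult G P b s \<in> T" using closed that i by (auto simp: T_eq)
    then show ?thesis using mult_mem_row[OF that(1), of s] that(2) z(2) by (auto simp: T_eq)
  qed
  then have "right_ideal (S\<lparr>carrier := T\<rparr>) (row i)"
    using i row_nonempty by (auto simp: right_ideal_def subact_def regular_act_def T_eq)
  then have T_row: "row i = T"
    using T by (auto simp: right_group_def)
  \<comment> \<open>The nonempty row of \<open>j\<close> lies in \<open>T\<close>, hence in
    \<open>row i\<close>, and distinct rows are disjoint.\<close>
  have "j = i" if "j \<in> I" for j
  proof -
    obtain x where "x \<in> row j" using row_nonempty by blast
    moreover from this have "x \<in> row i" using T_row T_eq that by blast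
    ultimately show ?thesis by (auto elim!: row_cases)
  qed
  then show ?thesis using i by (auto simp: is_singleton_def)
qed

end

theorem corollary3p9:
  fixes G :: "('g, 'm) monoid_scheme"
    and I :: "'i set" and \<Lambda> :: "'l set"
    and P :: "'l \<Rightarrow> 'i \<Rightarrow> 'g option"
    and S :: "('i \<times> 'g \<times> 'l) option sgrp"
  assumes "group G" and "I \<noteq> {}" and "\<Lambda> \<noteq> {}" and "regular_matrix G I \<Lambda> P"
    and "S = rees_matrix_semigroup G I \<Lambda> P"
  shows "(right_uniform S \<longleftrightarrow> is_singleton I) \<and> (right_uniform S \<longleftrightarrow> right_0_group S)"
proof -
  interpret regular_rees G I \<Lambda> P
    using assms by (simp add: regular_rees_def regular_rees_axioms_def)
  show ?thesis
    unfolding assms(5)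
    using is_singleton_I_if_right_uniform is_singleton_I_if_right_0_group
      right_uniform_if_singleton right_0_group_if_singleton
    by (metis is_singleton_def)
qed

end
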